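(* Let $E\subset \mathbb{T}$ be a compact set of positive Lebesgue measure with finite Beurling--Carleson entropy. Then the indicator function $1_E$ satisfies the Fourier decay $$\sum_{n\in \mathbb{Z}} \log(1+|n|)\, |\widehat{1_E}(n)|^2 < \infty.$$
   Context: $\mathbb{T}$ is the unit circle. A compact set $E\subset\mathbb{T}$ has finite Beurling--Carleson entropy if $\sum_k |I_k|\log\frac{1}{|I_k|}<\infty$, where $\{I_k\}_k$ are the connected components of $\mathbb{T}\setminus E$ and $|I_k|$ denotes length. $\widehat{1_E}(n)$ are the Fourier coefficients of $1_E$. *)

theory Defs
  imports "HOL-Analysis.Analysis"
begin

abbreviation unit_circle :: "complex set" where
  "unit_circle \<equiv> sphere 0 1"

text \<open>Arc length on the unit circle (total mass \<open>2 * pi\<close>), as a Borel measure on the complex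
  plane that vanishes off the circle.\<close>

definition arc_length :: "complex measure" where
  "arc_length = distr (restrict_space lborel {0..<2 * pi}) borel cis"

text \<open>The complement of a compact set has at most countably many components, and at most finitely
  many of them have length at least 1, so only finitely many summands are nonpositive and
  unconditional summability is convergence of the series in any enumeration.\<close>

definition finite_BC_entropy :: "complex set \<Rightarrow> bool" where
  "finite_BC_entropy E \<longleftrightarrow>
     (\<lambda>I. measure arc_length I * ln (1 / measure arc_length I))
       summable_on components (unit_circle - E)"

definition fourier_coeff :: "(complex \<Rightarrow> complex) \<Rightarrow> int \<Rightarrow> complex" where
  "fourier_coeff f n = (LINT z|arc_length. f z * z powi (- n)) / of_real (2 * pi)"

end

theory Submission
  imports Defs
begin

text \<open>Let \<open>c n\<close> be the Fourier coefficients of the indicator of \<open>E\<close>. Bessel's inequality for the difference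
  of that indicator and its rotation by an angle \<open>t\<close> bounds
  \<open>\<Sum>n. (2 - 2 * cos (n * t)) * \<bar>c n\<bar>\<^sup>2\<close> by a multiple of the measure of the points outside \<open>E\<close> that the
  rotation moves into \<open>E\<close>. Such a point of a complementary arc \<open>I\<close> lies within \<open>t\<close> of an endpoint, so
  that measure is at most \<open>\<Sum>I. min \<bar>I\<bar> t\<close>. Averaging over \<open>t \<in> [0, 2 * 2\<^sup>-\<^sup>j]\<close> bounds the tail
  \<open>\<bar>n\<bar> \<ge> 2\<^sup>j\<close> of the sum of the \<open>\<bar>c n\<bar>\<^sup>2\<close>. Summed over \<open>j\<close>, the tails count each \<open>\<bar>c n\<bar>\<^sup>2\<close> about
  \<open>log 2 \<bar>n\<bar>\<close> times, while the bounds add up to about \<open>\<bar>I\<bar> * log 2 (1 / \<bar>I\<bar>)\<close> for each arc.\<close>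

section \<open>Arc length: rotation invariance and integrals of powers\<close>

lemma sets_arc_length [simp, measurable_cong]: "sets arc_length = sets borel"
  by (simp add: arc_length_def)

lemma space_arc_length [simp]: "space arc_length = UNIV"
  by (simp add: arc_length_def)

lemma borel_measurable_cis [measurable]: "cis \<in> borel_measurable borel"
  by (intro borel_measurable_continuous_onI continuous_intros)

lemma emeasure_arc_length:
  assumes "A \<in> sets borel"
  shows "emeasure arc_length A = emeasure lborel ({0..<2 * pi} \<inter> cis -` A)"
proof -
  have "emeasure arc_length A =
      emeasure (restrict_space lborel {0..<2 * pi}) (cis -` A \<inter> space (restrict_space lborel {0..<2 * pi}))"
    unfolding arc_length_def using assms
    by (intro emeasure_distr measurable_restrict_space1) simp_all
  also have "\<dots> = emeasure lborel ({0..<2 * pi} \<inter> cis -` A)"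
    by (subst emeasure_restrict_space) (auto simp: Int_commute space_restrict_space)
  finally show ?thesis .
qed

lemma emeasure_arc_length_UNIV: "emeasure arc_length UNIV = ennreal (2 * pi)"
  by (subst emeasure_arc_length) auto

interpretation arc_length: finite_measure arc_length
  by standard (simp add: emeasure_arc_length_UNIV)

lemma emeasure_lborel_vimage_add:
  fixes B :: "real set"
  assumes "B \<in> sets borel"
  shows "emeasure lborel ((+) c -` B) = emeasure lborel B"
proof -
  have "emeasure (distr lborel borel ((+) c)) B = emeasure lborel ((+) c -` B \<inter> space lborel)"
    by (rule emeasure_distr) (use assms in auto)
  then show ?thesis by (simp add: lborel_distr_plus)
qed

text \<open>The angles of the points of \<open>A\<close> form a set of period \<open>2 * pi\<close>.
  Rotation shifts the window \<open>{0..<2 * pi}\<close> of angles to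
  \<open>{t..<t + 2 * pi}\<close>, and the part beyond \<open>2 * pi\<close> is carried back by one
  period onto \<open>{0..<t}\<close>.\<close>

lemma arc_length_rotate:
  assumes "cmod w = 1"
  shows "distr arc_length borel ((*) w) = arc_length"
proof (rule measure_eqI)
  fix A assume "A \<in> sets (distr arc_length borel ((*) w))"
  then have [measurable]: "A \<in> sets borel" by simp
  define t where "t = Arg2pi w"
  have t: "0 \<le> t" "t < 2 * pi" by (auto simp: t_def Arg2pi_ge_0 Arg2pi_lt_2pi)
  have w: "w = cis t"
    using assms complex_norm_eq_1_exp[of w] by (simp add: t_def cis_conv_exp)
  define P where "P a b = {a..<b} \<inter> cis -` A" for a b :: real
  have P [measurable]: "P a b \<in> sets borel" for a b
    unfolding P_def using measurable_sets[OF borel_measurable_cis, of A] by auto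
  have split: "emeasure lborel (P a c) = emeasure lborel (P a b) + emeasure lborel (P b c)"
    if "a \<le> b" "b \<le> c" for a b c
    using that by (subst plus_emeasure) (auto simp: P_def intro!: arg_cong[where f="emeasure lborel"])
  have "emeasure (distr arc_length borel ((*) w)) A = emeasure arc_length ((*) w -` A)"
    by (subst emeasure_distr) auto
  also have "\<dots> = emeasure lborel ({0..<2 * pi} \<inter> cis -` ((*) w -` A))"
    by (rule emeasure_arc_length) (use measurable_sets[of "(*) w" borel borel A] in auto)
  also have "{0..<2 * pi} \<inter> cis -` ((*) w -` A) = (+) t -` P t (t + 2 * pi)"
    by (auto simp: w P_def cis_mult)
  also have "emeasure lborel \<dots> = emeasure lborel (P t (t + 2 * pi))"
    by (rule emeasure_lborel_vimage_add) measurable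
  also have "\<dots> = emeasure lborel (P t (2 * pi)) + emeasure lborel (P (2 * pi) (t + 2 * pi))"
    using t by (intro split) auto
  also have "emeasure lborel (P (2 * pi) (t + 2 * pi))
      = emeasure lborel ((+) (2 * pi) -` P (2 * pi) (t + 2 * pi))"
    by (rule emeasure_lborel_vimage_add[symmetric]) measurable
  also have "(+) (2 * pi) -` P (2 * pi) (t + 2 * pi) = P 0 t"
    by (auto simp: P_def cis_mult[symmetric])
  also have "emeasure lborel (P t (2 * pi)) + emeasure lborel (P 0 t) = emeasure lborel (P 0 (2 * pi))"
    using t split[of 0 t "2 * pi"] by (simp add: add.commute)
  also have "\<dots> = emeasure arc_length A"
    by (simp add: emeasure_arc_length P_def)
  finally show "emeasure (distr arc_length borel ((*) w)) A = emeasure arc_length A" .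
qed simp

lemma emeasure_arc_length_rotate:
  assumes "cmod w = 1" "A \<in> sets borel"
  shows "emeasure arc_length ((*) w -` A) = emeasure arc_length A"
proof -
  have "emeasure arc_length A = emeasure (distr arc_length borel ((*) w)) A"
    using assms by (simp add: arc_length_rotate)
  also have "\<dots> = emeasure arc_length ((*) w -` A)"
    using assms by (subst emeasure_distr) auto
  finally show ?thesis by simp
qed

lemma integral_arc_length_rotate:
  fixes f :: "complex \<Rightarrow> complex"
  assumes "cmod w = 1" "f \<in> borel_measurable borel"
  shows "(LINT z|arc_length. f (w * z)) = (LINT z|arc_length. f z)"
proof -
  have "(LINT z|arc_length. f z) = (LINT z|distr arc_length borel ((*) w). f z)"
    using assms by (simp add: arc_length_rotate)
  also have "\<dots> = (LINT z|arc_length. f (w * z))"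
    using assms by (subst integral_distr) auto
  finally show ?thesis by simp
qed

lemma AE_arc_length: "AE z in arc_length. cmod z = 1"
proof (rule AE_I[where N = "- unit_circle"])
  show "emeasure arc_length (- unit_circle) = 0"
    by (subst emeasure_arc_length) (auto simp: vimage_def)
qed auto

lemma borel_measurable_power_int [measurable]:
  "(\<lambda>z::complex. z powi n) \<in> borel_measurable borel"
  unfolding power_int_def by (cases "n \<ge> 0") auto

lemma integrable_arc_length:
  fixes f :: "complex \<Rightarrow> complex"
  assumes "f \<in> borel_measurable borel" "\<And>z. cmod z = 1 \<Longrightarrow> cmod (f z) \<le> B"
  shows "integrable arc_length f"
  by (rule arc_length.integrable_const_bound[where B = B])
    (use assms AE_arc_length in \<open>auto simp: measurable_cong_sets[OF sets_arc_length refl]\<close>)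

lemma integral_power_int:
  "(LINT z|arc_length. z powi n) = (if n = 0 then of_real (2 * pi) else 0)"
proof (cases "n = 0")
  case True
  then show ?thesis
    by (simp add: measure_def emeasure_arc_length_UNIV scaleR_conv_of_real)
next
  case False
  \<comment> \<open>rotating by this root of \<open>-1\<close> changes the sign of the integral\<close>
  define w where "w = cis (pi / of_int n)"
  have "w powi n = -1"
    using False by (simp add: w_def Complex.cis_power_int)
  then have "(LINT z|arc_length. z powi n) = (LINT z|arc_length. - (z powi n))"
    by (subst integral_arc_length_rotate[of w, symmetric])
       (auto simp: w_def power_int_mult_distrib)
  then show ?thesis using False by simp
qed

section \<open>Components of the complement of a compact set\<close>

text \<open>The circle is locally connected, so the components of the relatively open complement are
  relatively open, hence Borel. By the Lindelof property countably many of them cover the rest, and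
  disjointness leaves no further ones.\<close>

lemma countable_components_circle:
  assumes "compact E"
  shows "countable (components (unit_circle - E))"
    and "components (unit_circle - E) \<subseteq> sets borel"
proof -
  have op: "openin (top_of_set unit_circle) (unit_circle - E)"
    using assms by (simp add: compact_imp_closed openin_diff openin_subtopology_self
      closedin_closed_Int Diff_Int2 open_openin[symmetric] openin_open_Int Diff_eq open_Compl)
  then have lc: "locally connected (unit_circle - E)"
    using locally_connected_sphere locally_open_subset by blast
  have opc: "openin (top_of_set unit_circle) C" if "C \<in> components (unit_circle - E)" for C
    using openin_components_locally_connected[OF lc that] op openin_trans by blast
  then obtain F' where F': "F' \<subseteq> components (unit_circle - E)" "countable F'"
      "\<Union>F' = \<Union>(components (unit_circle - E))"
    using Lindelof_openin[of "components (unit_circle - E)" unit_circle] by metis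
  have "components (unit_circle - E) \<subseteq> F'"
  proof
    fix C assume C: "C \<in> components (unit_circle - E)"
    then obtain x where "x \<in> C" using in_components_nonempty by blast
    with C F' obtain D where "D \<in> F'" "x \<in> D" by blast
    with C F' \<open>x \<in> C\<close> have "C = D" using components_eq[of C _ D] by blast
    with \<open>D \<in> F'\<close> show "C \<in> F'" by simp
  qed
  with F' show "countable (components (unit_circle - E))" using countable_subset by blast
  show "components (unit_circle - E) \<subseteq> sets borel"
  proof
    fix C assume "C \<in> components (unit_circle - E)"
    then obtain T where "open T" "C = unit_circle \<inter> T"
      using opc openin_open by metis
    then show "C \<in> sets borel" by auto
  qed
qed

section \<open>Points that a rotation moves out of an arc or into \<open>E\<close>\<close>

text \<open>Angles measured from \<open>p\<close> turn \<open>I\<close> into an interval, and a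
  point that the rotation pushes out of it lies within \<open>t\<close> of its upper end.\<close>

lemma emeasure_exit_arc_le:
  assumes I: "connected I" "I \<subseteq> unit_circle" and [measurable]: "I \<in> sets borel"
    and p: "cmod p = 1" "p \<notin> I" and "0 \<le> t"
  shows "emeasure arc_length {z \<in> I. cis t * z \<notin> I} \<le> ennreal t"
proof -
  define S where "S = {z \<in> I. cis t * z \<notin> I}"
  have [measurable]: "S \<in> sets borel" unfolding S_def by measurable
  \<comment> \<open>cutting the circle at \<open>p\<close> turns \<open>I\<close> into the interval \<open>J\<close> of angles\<close>
  define J where "J = {x \<in> {0..<2 * pi}. p * cis x \<in> I}"
  define X where "X = {0..<2 * pi} \<inter> cis -` ((*) p -` S)"
  have p0: "p \<noteq> 0" using p by auto
  have "J = (\<lambda>z. Arg2pi (z / p)) ` I"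
  proof (intro equalityI subsetI)
    fix x assume x: "x \<in> J"
    then have "Arg2pi (cis x) = x"
      by (intro Arg2pi_unique[of 1]) (auto simp: J_def cis_conv_exp)
    then have "x = Arg2pi (p * cis x / p)" using p0 by simp
    with x show "x \<in> (\<lambda>z. Arg2pi (z / p)) ` I"
      by (intro image_eqI[of _ _ "p * cis x"]) (simp_all add: J_def)
  next
    fix x assume "x \<in> (\<lambda>z. Arg2pi (z / p)) ` I"
    then obtain z where z: "z \<in> I" "x = Arg2pi (z / p)" by auto
    then have "cmod (z / p) = 1" using I p by (auto simp: norm_divide)
    then have "cis x = z / p"
      using complex_norm_eq_1_exp[of "z / p"] z by (simp add: cis_conv_exp)
    then show "x \<in> J" using z p0 by (auto simp: J_def Arg2pi_ge_0 Arg2pi_lt_2pi)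
  qed
  moreover have "continuous_on I (\<lambda>z. Arg2pi (z / p))"
  proof (rule continuous_at_imp_continuous_on, rule ballI)
    fix z assume z: "z \<in> I"
    \<comment> \<open>\<open>Arg2pi\<close> jumps only across the nonnegative real axis, which
      \<open>z / p\<close> meets only for \<open>z = p\<close>, a point outside
      \<open>I\<close>.\<close>
    have "z / p \<notin> \<real>\<^sub>\<ge>\<^sub>0"
    proof
      assume "z / p \<in> \<real>\<^sub>\<ge>\<^sub>0"
      then obtain r where r: "r \<ge> 0" "z / p = of_real r" by (auto elim: nonneg_Reals_cases)
      moreover have "cmod (z / p) = 1" using I p z by (auto simp: norm_divide)
      ultimately have "z / p = 1" by simp
      with p0 z p show False by simp
    qed
    then show "isCont (\<lambda>z. Arg2pi (z / p)) z"
      by (intro isCont_o2[OF _ continuous_at_Arg2pi] continuous_intros p0)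
  qed
  ultimately have "connected J" using I connected_continuous_image by metis
  have bdd: "bdd_above J" unfolding J_def by (rule bdd_aboveI[of _ "2 * pi"]) auto
  have X: "X \<subseteq> {Sup J - t..Sup J}"
  proof
    fix x assume x: "x \<in> X"
    then have xJ: "x \<in> J" by (auto simp: X_def J_def S_def)
    \<comment> \<open>Otherwise the interval \<open>J\<close> would contain \<open>x + t\<close>,
      and the rotated point would still lie in \<open>I\<close>.\<close>
    have "\<not> x + t < Sup J"
    proof
      assume "x + t < Sup J"
      then obtain y where "y \<in> J" "x + t < y"
        using less_cSup_iff[OF _ bdd] xJ by auto
      then have "x + t \<in> J"
        using connectedD_interval[OF \<open>connected J\<close> xJ, of y "x + t"] \<open>0 \<le> t\<close> by auto
      with x show False by (auto simp: J_def X_def S_def cis_mult[symmetric] mult_ac)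
    qed
    with xJ cSup_upper[OF xJ bdd] show "x \<in> {Sup J - t..Sup J}" by auto
  qed
  have "emeasure arc_length S = emeasure arc_length ((*) p -` S)"
    using p by (intro emeasure_arc_length_rotate[symmetric]) auto
  also have "\<dots> = emeasure lborel X"
    unfolding X_def by (rule emeasure_arc_length) (use measurable_sets[of "(*) p" borel borel S] in auto)
  also have "\<dots> \<le> emeasure lborel {Sup J - t..Sup J}"
    using X by (rule emeasure_mono) auto
  also have "\<dots> = ennreal t" using \<open>0 \<le> t\<close> by simp
  finally show ?thesis by (simp add: S_def)
qed

text \<open>A point entering \<open>E\<close> starts in exactly one component \<open>I\<close> and
  leaves it. So each \<open>I\<close> contributes at most its length and, by
  \<open>emeasure_exit_arc_le\<close>, at most \<open>t\<close>. A single point \<open>p\<close> of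
  \<open>E\<close> serves as the cut for all arcs.\<close>

lemma emeasure_enter_le:
  assumes E: "E \<subseteq> unit_circle" "compact E" "E \<noteq> {}" and "0 \<le> t"
  shows "emeasure arc_length {z. z \<notin> E \<and> cis t * z \<in> E}
    \<le> (\<integral>\<^sup>+ I. ennreal (min (measure arc_length I) t) \<partial>count_space (components (unit_circle - E)))"
proof -
  note comp = countable_components_circle[OF \<open>compact E\<close>]
  have [measurable]: "E \<in> sets borel" by (rule borel_closed[OF compact_imp_closed[OF E(2)]])
  obtain p where p: "p \<in> E" using E by auto
  then have p1: "cmod p = 1" using E(1) by (metis mem_sphere_0 subsetD)
  define X where "X I = {z \<in> I. cis t * z \<in> E}" for I
  have X_sets: "X I \<in> sets borel" if "I \<in> components (unit_circle - E)" for I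
  proof -
    have [measurable]: "I \<in> sets borel" using that comp(2) by blast
    show ?thesis unfolding X_def by measurable
  qed
  have "{z. z \<notin> E \<and> cis t * z \<in> E} = \<Union>(X ` components (unit_circle - E))"
  proof -
    \<comment> \<open>The set ranges over the whole plane; only the rotated point being in
      \<open>E\<close> puts \<open>z\<close> on the circle.\<close>
    have "z \<in> unit_circle" if "cis t * z \<in> E" for z
      using subsetD[OF E(1) that] by (simp add: norm_mult)
    then have "{z. z \<notin> E \<and> cis t * z \<in> E} = {z \<in> \<Union>(components (unit_circle - E)). cis t * z \<in> E}"
      by (subst Union_components[symmetric]) auto
    also have "\<dots> = \<Union>(X ` components (unit_circle - E))" unfolding X_def by blast
    finally show ?thesis .
  qed
  also have "emeasure arc_length \<dots>
      = (\<integral>\<^sup>+ I. emeasure arc_length (X I) \<partial>count_space (components (unit_circle - E)))"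
  proof (rule emeasure_UN_countable)
    show "disjoint_family_on X (components (unit_circle - E))"
      unfolding disjoint_family_on_def
    proof (intro ballI impI)
      fix I J assume "I \<in> components (unit_circle - E)" "J \<in> components (unit_circle - E)" "I \<noteq> J"
      then have "I \<inter> J = {}" by (simp add: components_nonoverlap)
      then show "X I \<inter> X J = {}" by (auto simp: X_def)
    qed
  qed (use comp(1) X_sets in simp_all)
  also have "\<dots> \<le> (\<integral>\<^sup>+ I. ennreal (min (measure arc_length I) t) \<partial>count_space (components (unit_circle - E)))"
  proof (rule nn_integral_mono)
    fix I assume "I \<in> space (count_space (components (unit_circle - E)))"
    then have I: "I \<in> components (unit_circle - E)" by simp
    then have sub: "I \<subseteq> unit_circle - E" by (rule in_components_subset)
    have "emeasure arc_length (X I) \<le> emeasure arc_length I"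
      using I comp(2) by (intro emeasure_mono) (auto simp: X_def)
    moreover have "emeasure arc_length (X I) \<le> ennreal t"
    proof -
      have "emeasure arc_length (X I) \<le> emeasure arc_length {z \<in> I. cis t * z \<notin> I}"
      proof (rule emeasure_mono)
        have [measurable]: "I \<in> sets borel" using I comp(2) by blast
        show "{z \<in> I. cis t * z \<notin> I} \<in> sets arc_length" by measurable
      qed (use sub in \<open>auto simp: X_def\<close>)
      also have "\<dots> \<le> ennreal t"
        using I sub p p1 \<open>0 \<le> t\<close> in_components_connected[OF I] comp(2)
        by (intro emeasure_exit_arc_le[of I p]) auto
      finally show ?thesis .
    qed
    ultimately show "emeasure arc_length (X I) \<le> ennreal (min (measure arc_length I) t)"
      by (auto simp: min_def arc_length.emeasure_eq_measure)
  qed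
  finally show ?thesis .
qed

section \<open>The dyadic sum for a single arc\<close>

text \<open>For small \<open>l\<close> about \<open>log 2 (1 / l)\<close> scales exceed
  \<open>l\<close> and contribute \<open>l\<close> each, while the others form a geometric series of
  size comparable to \<open>l\<close>. The range up to 8 leaves room for the full length
  \<open>2 * pi\<close>.\<close>

lemma sum_min_dyadic_le:
  fixes l :: real
  assumes "0 \<le> l" "l \<le> 8"
  shows "(\<Sum>j<M. min l (2 * (1/2) ^ j)) \<le> 7 * l + l * log 2 (1 / l)"
proof -
  have geo: "(\<Sum>j<N. 2 * (1/2) ^ j) \<le> (4::real)" for N
    by (simp add: sum_distrib_left[symmetric] sum_gp_strict)
  consider "l = 0" | "1 \<le> l" | "0 < l" "l < 1" using assms by linarith
  then show ?thesis
  proof cases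
    case 1
    then show ?thesis by simp
  next
    case 2
    \<comment> \<open>The logarithmic term may be negative here, but is at least
      \<open>- 3 * l\<close>. Together with a geometric sum of at most 4, hence at most
      \<open>4 * l\<close>, this gives the constant 7.\<close>
    have "log 2 l \<le> log 2 (2 ^ 3)" using assms 2 by (subst log_le_cancel_iff) auto
    then have "log 2 l \<le> 3" by (subst (asm) log_pow_cancel) auto
    then have "l * log 2 l \<le> l * 3" using 2 by (intro mult_left_mono) auto
    moreover have "(\<Sum>j<M. min l (2 * (1/2) ^ j)) \<le> (\<Sum>j<M. 2 * (1/2) ^ j)"
      by (intro sum_mono) auto
    moreover have "l * log 2 (1 / l) = - (l * log 2 l)"
      using 2 by (simp add: log_divide)
    ultimately show ?thesis using geo[of M] 2 by linarith
  next
    case 3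
    \<comment> \<open>\<open>m\<close> is the first index with \<open>(1/2) ^ m \<le> l\<close>; the
      sum is split there.\<close>
    define m where "m = nat \<lceil>log 2 (1 / l)\<rceil>"
    have pos: "log 2 (1 / l) > 0" using 3 by simp
    have m1: "log 2 (1 / l) \<le> m" and m2: "m \<le> log 2 (1 / l) + 1"
      using pos unfolding m_def by linarith+
    have "1 / l \<le> 2 ^ m"
      using m1 3 by (simp add: log_le_iff powr_realpow)
    then have ml: "(1/2) ^ m \<le> l" using 3 by (simp add: field_simps power_one_over)
    have "(\<Sum>j<M. min l (2 * (1/2) ^ j)) \<le> (\<Sum>j<m + M. min l (2 * (1/2) ^ j))"
      using 3 by (intro sum_mono2) auto
    moreover have "(\<Sum>j<m + M. min l (2 * (1/2) ^ j))
        = (\<Sum>j<m. min l (2 * (1/2) ^ j)) + (\<Sum>j<M. min l (2 * (1/2) ^ (m + j)))"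
      by (induction M) (simp_all add: add.assoc)
    moreover have "(\<Sum>j<m. min l (2 * (1/2) ^ j)) \<le> (\<Sum>j<m. l)"
      by (intro sum_mono) auto
    moreover have "(\<Sum>j<m. l) \<le> (log 2 (1 / l) + 1) * l"
      using mult_right_mono[OF m2, of l] 3 by simp
    moreover have "(\<Sum>j<M. min l (2 * (1/2) ^ (m + j))) \<le> l * 4"
    proof -
      have "(\<Sum>j<M. min l (2 * (1/2) ^ (m + j))) \<le> (\<Sum>j<M. (1/2) ^ m * (2 * (1/2) ^ j))"
        by (intro sum_mono min.coboundedI2) (simp add: power_add)
      also have "\<dots> = (1/2) ^ m * (\<Sum>j<M. 2 * (1/2) ^ j)"
        by (simp only: sum_distrib_left)
      also have "\<dots> \<le> l * 4"
        using ml geo[of M] 3 by (intro mult_mono) (auto intro: sum_nonneg)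
      finally show ?thesis .
    qed
    ultimately have "(\<Sum>j<M. min l (2 * (1/2) ^ j)) \<le> (log 2 (1 / l) + 1) * l + l * 4"
      by linarith
    also have "\<dots> = l * log 2 (1 / l) + 5 * l" by (simp add: ring_distribs)
    also have "\<dots> \<le> 7 * l + l * log 2 (1 / l)" using 3 by linarith
    finally show ?thesis .
  qed
qed

section \<open>Bessel's inequality and rotated functions\<close>

lemma cmod_power_int_circle [simp]: "cmod z = 1 \<Longrightarrow> cmod (z powi n) = 1"
  by (simp add: norm_power_int)

lemma cnj_power_int_circle:
  assumes "cmod z = 1"
  shows "cnj (z powi n) = z powi (- n)"
proof -
  have "z powi n * cnj (z powi n) = 1"
    using complex_norm_square[of "z powi n"] assms by simp
  then show ?thesis
    by (simp only: power_int_minus inverse_unique)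
qed

lemma borel_measurable_cnj [measurable]: "cnj \<in> borel_measurable borel"
  by (intro borel_measurable_continuous_onI continuous_intros)

text \<open>Expand the nonnegative integral of the squared distance between \<open>f\<close> and its
  partial Fourier sum \<open>S\<close>, using orthogonality of the powers.\<close>

lemma bessel_circle:
  fixes f :: "complex \<Rightarrow> complex"
  assumes [measurable]: "f \<in> borel_measurable borel" and bd: "\<And>z. cmod (f z) \<le> B" and "finite F"
  shows "(\<Sum>n\<in>F. (cmod (fourier_coeff f n))\<^sup>2) \<le> (LINT z|arc_length. (cmod (f z))\<^sup>2) / (2 * pi)"
proof -
  define c where "c = fourier_coeff f"
  define S where "S z = (\<Sum>n\<in>F. c n * z powi n)" for z
  \<comment> \<open>\<open>T\<close> is the conjugate of \<open>S\<close> on the circle, written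
    with integer powers so that products expand into known integrals.\<close>
  define T where "T z = (\<Sum>n\<in>F. cnj (c n) * z powi (- n))" for z
  define A where "A = (\<Sum>n\<in>F. (cmod (c n))\<^sup>2)"
  have [measurable]: "S \<in> borel_measurable borel" "T \<in> borel_measurable borel"
    unfolding S_def T_def by measurable
  have B0: "B \<ge> 0" using bd[of 0] norm_ge_zero order_trans by blast
  have cc: "cnj (c n) * c n = of_real ((cmod (c n))\<^sup>2)" for n
    by (subst mult.commute) (rule complex_norm_square[symmetric])
  have coeff: "(LINT z|arc_length. f z * z powi (- n)) = of_real (2 * pi) * c n" for n
    by (simp add: c_def fourier_coeff_def)
  have int1: "integrable arc_length (\<lambda>z. f z * z powi n)" for n
    by (rule integrable_arc_length[where B = B]) (auto simp: norm_mult bd)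
  have int2: "integrable arc_length (\<lambda>z. z powi n)" for n
    by (rule integrable_arc_length[where B = 1]) auto
  have int3: "integrable arc_length (\<lambda>z. f z * cnj (f z))"
    by (rule integrable_arc_length[where B = "B * B"]) (auto simp: norm_mult bd B0 intro: mult_mono)
  have fT: "integrable arc_length (\<lambda>z. f z * T z)"
           "(LINT z|arc_length. f z * T z) = of_real (2 * pi * A)"
  proof -
    have eq: "f z * T z = (\<Sum>n\<in>F. cnj (c n) * (f z * z powi (- n)))" for z
      by (simp add: T_def sum_distrib_left mult_ac)
    show "integrable arc_length (\<lambda>z. f z * T z)"
      unfolding eq by (intro Bochner_Integration.integrable_sum integrable_mult_right int1)
    have "(LINT z|arc_length. f z * T z)
        = (\<Sum>n\<in>F. cnj (c n) * (LINT z|arc_length. f z * z powi (- n)))"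
      unfolding eq by (subst Bochner_Integration.integral_sum) (simp_all add: int1)
    also have "\<dots> = of_real (2 * pi * A)"
      unfolding coeff A_def by (simp add: sum_distrib_left cc[symmetric] mult_ac del: of_real_power)
    finally show "(LINT z|arc_length. f z * T z) = of_real (2 * pi * A)" .
  qed
  have ST: "integrable arc_length (\<lambda>z. S z * T z)"
           "(LINT z|arc_length. S z * T z) = of_real (2 * pi * A)"
  proof -
    \<comment> \<open>Combining the exponents fails at \<open>z = 0\<close>, so the identity is
      taken almost everywhere.\<close>
    have eq: "AE z in arc_length. S z * T z = (\<Sum>n\<in>F. \<Sum>m\<in>F. c n * cnj (c m) * z powi (n - m))"
      using AE_arc_length
    proof eventually_elim
      case (elim z)
      then have "z \<noteq> 0" by auto
      then show ?case
        by (auto simp: S_def T_def sum_product power_int_diff power_int_minus field_simps intro!: sum.cong)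
    qed
    have int: "integrable arc_length (\<lambda>z. \<Sum>n\<in>F. \<Sum>m\<in>F. c n * cnj (c m) * z powi (n - m))"
      by (intro Bochner_Integration.integrable_sum integrable_mult_right int2)
    show "integrable arc_length (\<lambda>z. S z * T z)"
      by (rule integrable_cong_AE_imp[OF int]) (use AE_symmetric[OF eq] in simp_all)
    have "(LINT z|arc_length. S z * T z)
        = (LINT z|arc_length. (\<Sum>n\<in>F. \<Sum>m\<in>F. c n * cnj (c m) * z powi (n - m)))"
      by (rule integral_cong_AE) (use eq in auto)
    also have "\<dots> = (\<Sum>n\<in>F. \<Sum>m\<in>F. c n * cnj (c m) * (LINT z|arc_length. z powi (n - m)))"
      by (simp add: Bochner_Integration.integral_sum int2)
    also have "\<dots> = (\<Sum>n\<in>F. \<Sum>m\<in>F. if m = n then c n * cnj (c n) * of_real (2 * pi) else 0)"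
      by (auto simp: integral_power_int intro!: sum.cong)
    also have "\<dots> = (\<Sum>n\<in>F. c n * cnj (c n) * of_real (2 * pi))"
      using \<open>finite F\<close> by simp
    also have "\<dots> = of_real (2 * pi * A)"
      by (simp add: A_def sum_distrib_left cc[symmetric] mult_ac del: of_real_power)
    finally show "(LINT z|arc_length. S z * T z) = of_real (2 * pi * A)" .
  qed
  have cS: "AE z in arc_length. T z = cnj (S z)"
    using AE_arc_length
    by eventually_elim (simp add: S_def T_def cnj_power_int_circle del: complex_cnj_power_int)
  have Sf: "integrable arc_length (\<lambda>z. S z * cnj (f z))"
           "(LINT z|arc_length. S z * cnj (f z)) = of_real (2 * pi * A)"
  proof -
    have eq: "AE z in arc_length. S z * cnj (f z) = cnj (f z * T z)"
      using cS by eventually_elim simp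
    have int: "integrable arc_length (\<lambda>z. cnj (f z * T z))"
      by (rule integrable_cnj[OF fT(1)])
    show "integrable arc_length (\<lambda>z. S z * cnj (f z))"
      by (rule integrable_cong_AE_imp[OF int]) (use AE_symmetric[OF eq] in simp_all)
    have "(LINT z|arc_length. S z * cnj (f z)) = (LINT z|arc_length. cnj (f z * T z))"
      by (rule integral_cong_AE) (use eq in auto)
    also have "\<dots> = cnj (of_real (2 * pi * A))" by (simp only: Bochner_Integration.integral_cnj fT(2))
    finally show "(LINT z|arc_length. S z * cnj (f z)) = of_real (2 * pi * A)" by simp
  qed
  have "0 \<le> (LINT z|arc_length. (cmod (f z - S z))\<^sup>2)" by simp
  also have "complex_of_real \<dots> = (LINT z|arc_length. of_real ((cmod (f z - S z))\<^sup>2))"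
    by (rule integral_complex_of_real[symmetric])
  also have "\<dots> = (LINT z|arc_length. f z * cnj (f z) - f z * T z - S z * cnj (f z) + S z * T z)"
  proof (rule integral_cong_AE)
    show "AE z in arc_length. of_real ((cmod (f z - S z))\<^sup>2)
        = f z * cnj (f z) - f z * T z - S z * cnj (f z) + S z * T z"
      using cS by eventually_elim (simp add: complex_norm_square algebra_simps del: of_real_power)
  qed simp_all
  \<comment> \<open>Both mixed terms and the square of \<open>S\<close> integrate to
    \<open>2 * pi * A\<close>, so one copy remains with a minus sign.\<close>
  also have "\<dots> = (LINT z|arc_length. f z * cnj (f z)) - of_real (2 * pi * A)"
    using fT ST Sf int3 by simp
  also have "(LINT z|arc_length. f z * cnj (f z)) = of_real (LINT z|arc_length. (cmod (f z))\<^sup>2)"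
    by (simp only: complex_norm_square[symmetric] integral_complex_of_real)
  \<comment> \<open>The chain runs in the complex numbers, whose order compares real parts at equal
    imaginary parts.\<close>
  finally have "2 * pi * A \<le> (LINT z|arc_length. (cmod (f z))\<^sup>2)"
    by (simp add: less_eq_complex_def del: of_real_power)
  then show ?thesis by (simp add: A_def c_def field_simps)
qed

lemma fourier_coeff_rotate:
  assumes w: "cmod w = 1" and [measurable]: "f \<in> borel_measurable borel"
  shows "fourier_coeff (\<lambda>z. f (w * z)) n = w powi n * fourier_coeff f n"
proof -
  have w0: "w \<noteq> 0" using w by auto
  have "(LINT z|arc_length. f (w * z) * z powi (- n))
      = (LINT z|arc_length. w powi n * (f (w * z) * (w * z) powi (- n)))"
    using w0 by (intro Bochner_Integration.integral_cong refl)
      (simp add: power_int_mult_distrib power_int_minus field_simps)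
  also have "\<dots> = (LINT z|arc_length. w powi n * (f z * z powi (- n)))"
    using w by (rule integral_arc_length_rotate[of w "\<lambda>z. w powi n * (f z * z powi (- n))"]) measurable
  finally show ?thesis by (simp add: fourier_coeff_def)
qed

section \<open>From rotations to tails of the Fourier coefficients\<close>

text \<open>Bessel's inequality for the rotated indicator minus the original one: its coefficients
  carry the factor \<open>cis t powi n - 1\<close>, whose squared modulus is the weight
  \<open>2 - 2 * cos (n * t)\<close>.\<close>

lemma sum_fourier_coeff_le_enter:
  assumes [measurable]: "E \<in> sets borel" and "finite F"
  shows "(\<Sum>n\<in>F. (2 - 2 * cos (of_int n * t)) * (cmod (fourier_coeff (indicator E) n))\<^sup>2)
    \<le> measure arc_length {z. z \<notin> E \<and> cis t * z \<in> E} / pi"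
proof -
  define f :: "complex \<Rightarrow> complex" where "f z = indicator E (cis t * z) - indicator E z" for z
  define R where "R = (*) (cis t) -` E"
  have [measurable]: "R \<in> sets borel"
    using measurable_sets[of "(*) (cis t)" borel borel E] by (simp add: R_def)
  have [measurable]: "f \<in> borel_measurable borel" unfolding f_def by measurable
  have int: "integrable arc_length (\<lambda>z. indicator E (cis t * z) * z powi n :: complex)"
            "integrable arc_length (\<lambda>z. indicator E z * z powi n :: complex)" for n
    by (rule integrable_arc_length[where B = 1]; auto simp: norm_mult indicator_def)+
  have "fourier_coeff f n = (cis t powi n - 1) * fourier_coeff (indicator E) n" for n
  proof -
    have "fourier_coeff f n
        = fourier_coeff (\<lambda>z. indicator E (cis t * z)) n - fourier_coeff (indicator E) n"
      unfolding fourier_coeff_def f_def by (simp add: left_diff_distrib int diff_divide_distrib)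
    then show ?thesis
      by (subst (asm) fourier_coeff_rotate) (auto simp: algebra_simps)
  qed
  moreover have "(cmod (cis t powi n - 1))\<^sup>2 = 2 - 2 * cos (of_int n * t)" for n
  proof -
    have "(cmod (cis s - 1))\<^sup>2 = 2 - 2 * cos s" for s
      using sin_cos_squared_add[of s] unfolding cmod_power2 by (simp add: power2_eq_square algebra_simps)
    then show ?thesis by (simp add: Complex.cis_power_int)
  qed
  ultimately have "(\<Sum>n\<in>F. (2 - 2 * cos (of_int n * t)) * (cmod (fourier_coeff (indicator E) n))\<^sup>2)
      = (\<Sum>n\<in>F. (cmod (fourier_coeff f n))\<^sup>2)"
    by (simp add: norm_mult power_mult_distrib)
  also have "\<dots> \<le> (LINT z|arc_length. (cmod (f z))\<^sup>2) / (2 * pi)"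
    by (rule bessel_circle[where B = 1]) (auto simp: f_def indicator_def \<open>finite F\<close>)
  also have "(LINT z|arc_length. (cmod (f z))\<^sup>2)
      = (LINT z|arc_length. indicator (R - E) z + indicator (E - R) z)"
    by (intro Bochner_Integration.integral_cong) (auto simp: f_def R_def indicator_def)
  also have "\<dots> = measure arc_length (R - E) + measure arc_length (E - R)"
    by (subst Bochner_Integration.integral_add)
       (simp_all add: arc_length.emeasure_eq_measure integrable_indicator_iff)
  \<comment> \<open>By rotation invariance \<open>R\<close> and \<open>E\<close> have equal measure,
    so both halves of the symmetric difference do too. The resulting factor 2 cancels against
    \<open>2 * pi\<close>.\<close>
  also have "measure arc_length (E - R) = measure arc_length (R - E)"
  proof -
    have "measure arc_length R = measure arc_length E"
      using emeasure_arc_length_rotate[of "cis t" E] by (simp add: measure_def R_def)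
    moreover have "measure arc_length R = measure arc_length (R - E) + measure arc_length (R \<inter> E)"
      by (subst arc_length.finite_measure_Union[symmetric]) (auto intro!: arg_cong[where f="measure arc_length"])
    moreover have "measure arc_length E = measure arc_length (E - R) + measure arc_length (R \<inter> E)"
      by (subst arc_length.finite_measure_Union[symmetric]) (auto intro!: arg_cong[where f="measure arc_length"])
    ultimately show ?thesis by simp
  qed
  also have "R - E = {z. z \<notin> E \<and> cis t * z \<in> E}" by (auto simp: R_def)
  finally show ?thesis by simp
qed

text \<open>Integrate the previous bound over \<open>t\<close> in \<open>{0..T}\<close>. The weight
  has integral at least \<open>2 * T - 2 / \<bar>n\<bar>\<close>, and this is at least
  \<open>T\<close> once \<open>\<bar>n\<bar> * T\<close> reaches 2.\<close>

lemma sum_fourier_coeff_tail_le: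
  assumes [measurable]: "E \<in> sets borel" and "finite F" and "0 < T"
    and F: "\<And>n. n \<in> F \<Longrightarrow> 2 \<le> real_of_int \<bar>n\<bar> * T"
    and K: "\<And>t. 0 \<le> t \<Longrightarrow> t \<le> T \<Longrightarrow> measure arc_length {z. z \<notin> E \<and> cis t * z \<in> E} \<le> K"
  shows "(\<Sum>n\<in>F. (cmod (fourier_coeff (indicator E) n))\<^sup>2) \<le> K / pi"
proof -
  define a where "a n = (cmod (fourier_coeff (indicator E) n))\<^sup>2" for n
  have "((\<lambda>t. \<Sum>n\<in>F. (2 - 2 * cos (of_int n * t)) * a n) has_integral
      (\<Sum>n\<in>F. (2 * T - 2 * sin (of_int n * T) / of_int n) * a n)) {0..T}"
  proof (intro has_integral_sum \<open>finite F\<close> has_integral_mult_left)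
    fix n assume "n \<in> F"
    then have "n \<noteq> 0" using F by fastforce
    then have "((\<lambda>t. 2 - 2 * cos (of_int n * t)) has_integral
        (2 * T - 2 * sin (of_int n * T) / of_int n) - (2 * 0 - 2 * sin (of_int n * 0) / of_int n)) {0..T}"
      using \<open>0 < T\<close> by (intro fundamental_theorem_of_calculus)
        (auto simp flip: has_real_derivative_iff_has_vector_derivative
          intro!: derivative_eq_intros)
    then show "((\<lambda>t. 2 - 2 * cos (of_int n * t)) has_integral
        (2 * T - 2 * sin (of_int n * T) / of_int n)) {0..T}" by simp
  qed
  moreover have "((\<lambda>t. K / pi) has_integral T * (K / pi)) {0..T}"
    using has_integral_const_real[of "K / pi" 0 T] \<open>0 < T\<close> by simp
  moreover have "(\<Sum>n\<in>F. (2 - 2 * cos (of_int n * t)) * a n) \<le> K / pi" if "t \<in> {0..T}" for t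
    unfolding a_def
    by (rule order_trans[OF sum_fourier_coeff_le_enter])
      (use that K \<open>finite F\<close> in \<open>auto intro!: divide_right_mono\<close>)
  ultimately have "(\<Sum>n\<in>F. (2 * T - 2 * sin (of_int n * T) / of_int n) * a n) \<le> T * (K / pi)"
    by (rule has_integral_le)
  moreover have "(\<Sum>n\<in>F. T * a n) \<le> (\<Sum>n\<in>F. (2 * T - 2 * sin (of_int n * T) / of_int n) * a n)"
  proof (intro sum_mono mult_right_mono)
    fix n assume n: "n \<in> F"
    then have "n \<noteq> 0" using F by fastforce
    have "2 * sin (of_int n * T) / of_int n \<le> \<bar>2 * sin (of_int n * T) / of_int n\<bar>"
      by (rule abs_ge_self)
    also have "\<dots> = 2 * \<bar>sin (of_int n * T)\<bar> / of_int \<bar>n\<bar>" by (simp add: abs_mult)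
    also have "\<dots> \<le> 2 * 1 / of_int \<bar>n\<bar>" by (intro divide_right_mono mult_left_mono) auto
    also have "\<dots> \<le> T" using F[OF n] \<open>n \<noteq> 0\<close> by (simp add: field_simps)
    finally show "T \<le> 2 * T - 2 * sin (of_int n * T) / of_int n" by simp
  qed (simp add: a_def)
  ultimately have "T * (\<Sum>n\<in>F. a n) \<le> T * (K / pi)" by (simp add: sum_distrib_left)
  then show ?thesis using \<open>0 < T\<close> unfolding a_def by (simp only: mult_le_cancel_left_pos)
qed

section \<open>Entropy and summation over the dyadic scales\<close>

text \<open>Bounds the total over all arcs of the right-hand sides of
  \<open>sum_min_dyadic_le\<close>. The linear part is finite because disjoint arcs have finite
  total length; the logarithmic part is the entropy divided by \<open>ln 2\<close>.\<close>

lemma nn_integral_entropy_finite: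
  assumes "compact E" "finite_BC_entropy E"
  defines "l \<equiv> measure arc_length"
  shows "(\<integral>\<^sup>+ I. ennreal (7 * l I + l I * log 2 (1 / l I)) \<partial>count_space (components (unit_circle - E))) < \<infinity>"
proof -
  note comp = countable_components_circle[OF \<open>compact E\<close>]
  let ?C = "count_space (components (unit_circle - E))"
  have "disjoint_family_on (\<lambda>I. I) (components (unit_circle - E))"
    unfolding disjoint_family_on_def by (metis components_nonoverlap)
  then have "emeasure arc_length (\<Union>((\<lambda>I. I) ` components (unit_circle - E))) = (\<integral>\<^sup>+ I. emeasure arc_length I \<partial>?C)"
    using comp by (intro emeasure_UN_countable) auto
  then have "(\<integral>\<^sup>+ I. ennreal (l I) \<partial>?C) = emeasure arc_length (\<Union>(components (unit_circle - E)))"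
    by (simp add: l_def arc_length.emeasure_eq_measure)
  also have "\<dots> < \<infinity>"
    by (simp add: arc_length.emeasure_eq_measure)
  finally have "(\<integral>\<^sup>+ I. ennreal (l I) \<partial>?C) < \<infinity>" .
  then have int_l: "integrable ?C l"
    by (intro integrableI_nonneg) (auto simp: l_def)
  have "(\<lambda>I. l I * ln (1 / l I)) summable_on components (unit_circle - E)"
    using assms(2) by (simp add: finite_BC_entropy_def l_def)
  \<comment> \<open>Unconditional summability of reals is absolute summability, which is
    integrability for counting measure.\<close>
  then have "integrable ?C (\<lambda>I. l I * ln (1 / l I))"
    by (simp only: summable_on_iff_abs_summable_on_real[of "\<lambda>I. l I * ln (1 / l I)"]
        abs_summable_equivalent abs_summable_on_def)
  then have "integrable ?C (\<lambda>I. 7 * l I + l I * ln (1 / l I) / ln 2)"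
    using int_l by simp
  then have "integrable ?C (\<lambda>I. 7 * l I + l I * log 2 (1 / l I))"
    by (simp add: log_def)
  then have "(\<integral>\<^sup>+ I. ennreal (norm (7 * l I + l I * log 2 (1 / l I))) \<partial>?C) < \<infinity>"
    by (simp only: integrable_iff_bounded)
  then show ?thesis
    by (rule le_less_trans[rotated]) (auto intro!: nn_integral_mono ennreal_leI)
qed

text \<open>The count is the number of binary digits of \<open>m\<close>, hence at least the base 2
  logarithm of \<open>1 + m\<close>, which dominates \<open>ln\<close> since
  \<open>ln 2 \<le> 1\<close>.\<close>

lemma ln_le_count_dyadic:
  assumes "0 \<le> m" "m < 2 ^ M"
  shows "ln (1 + real_of_int m) \<le> (\<Sum>j<M. if 2 ^ j \<le> m then 1 else 0)"
  using assms
proof (induction M)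
  case 0
  then show ?case by simp
next
  case (Suc M)
  show ?case
  proof (cases "m < 2 ^ M")
    case True
    with Suc show ?thesis by auto
  next
    case False
    have "2 ^ j \<le> m" if "j < Suc M" for j
    proof -
      have "(2::int) ^ j \<le> 2 ^ M" using that by (intro power_increasing) auto
      with False show ?thesis by linarith
    qed
    then have "(\<Sum>j<Suc M. if 2 ^ j \<le> m then 1 else 0) = (\<Sum>j<Suc M. 1 :: real)"
      by (intro sum.cong) simp_all
    moreover have "ln (1 + real_of_int m) \<le> real (Suc M)"
    proof -
      \<comment> \<open>Integrality of \<open>m\<close> absorbs the added 1.\<close>
      have "1 + real_of_int m \<le> real_of_int (2 ^ Suc M)"
        using Suc.prems by linarith
      then have "ln (1 + real_of_int m) \<le> ln (2 ^ Suc M)"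
        using Suc.prems by (subst ln_le_cancel_iff) auto
      also have "\<dots> = real (Suc M) * ln 2" by (rule ln_realpow)
      also have "\<dots> \<le> real (Suc M) * 1"
        using ln_le_minus_one[of 2] by (intro mult_left_mono) auto
      finally show ?thesis by simp
    qed
    ultimately show ?thesis by simp
  qed
qed

theorem proposition5p5:
  fixes E :: "complex set"
  assumes "E \<subseteq> unit_circle"
    and "compact E"
    and "measure arc_length E > 0"
    and "finite_BC_entropy E"
  shows "(\<lambda>n::int. ln (1 + real_of_int \<bar>n\<bar>) * (cmod (fourier_coeff (indicator E) n))\<^sup>2)
           summable_on UNIV"
proof -
  define l where "l = measure arc_length"
  define a where "a n = (cmod (fourier_coeff (indicator E) n))\<^sup>2" for n
  let ?C = "count_space (components (unit_circle - E))"
  define \<nu> where "\<nu> t = (\<integral>\<^sup>+ I. ennreal (min (l I) t) \<partial>?C)" for t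
  define B where "B = (\<integral>\<^sup>+ I. ennreal (7 * l I + l I * log 2 (1 / l I)) \<partial>?C)"
  have [measurable]: "E \<in> sets borel"
    by (rule borel_closed[OF compact_imp_closed[OF assms(2)]])
  have "E \<noteq> {}" using assms(3) by auto
  have l0: "0 \<le> l I" and l8: "l I \<le> 8" for I
  proof -
    have "l I \<le> measure arc_length UNIV"
      unfolding l_def using arc_length.bounded_measure[of I] by simp
    also have "\<dots> = 2 * pi" by (simp add: measure_def emeasure_arc_length_UNIV)
    also have "\<dots> \<le> 8" using pi_less_4 by simp
    finally show "l I \<le> 8" .
  qed (simp add: l_def)
  have B: "B < \<infinity>"
    unfolding B_def l_def using assms(2,4) by (rule nn_integral_entropy_finite)
  \<comment> \<open>The sum over scales is moved inside the sum over arcs, where the estimate for a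
    single arc applies.\<close>
  have sum_\<nu>: "(\<Sum>j<M. \<nu> (2 * (1/2) ^ j)) \<le> B" for M
  proof -
    have "(\<Sum>j<M. \<nu> (2 * (1/2) ^ j)) = (\<integral>\<^sup>+ I. (\<Sum>j<M. ennreal (min (l I) (2 * (1/2) ^ j))) \<partial>?C)"
      unfolding \<nu>_def by (rule nn_integral_sum[symmetric]) simp
    also have "\<dots> \<le> B"
      unfolding B_def using l0 l8
      by (intro nn_integral_mono) (auto simp: sum_ennreal intro!: ennreal_leI sum_min_dyadic_le)
    finally show ?thesis .
  qed
  \<comment> \<open>\<open>enn2real\<close> sends infinity to 0, so finiteness comes before any
    passage to real bounds.\<close>
  have \<nu>_fin: "\<nu> (2 * (1/2) ^ j) < \<infinity>" for j
  proof -
    have "\<nu> (2 * (1/2) ^ j) \<le> (\<Sum>i<Suc j. \<nu> (2 * (1/2) ^ i))"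
      by (rule member_le_sum) auto
    also have "\<dots> < \<infinity>" using sum_\<nu> B by (rule le_less_trans)
    finally show ?thesis .
  qed
  \<comment> \<open>\<open>\<nu>\<close> is monotone, so its value at the end of the scale serves
    for all smaller angles.\<close>
  have enter: "measure arc_length {z. z \<notin> E \<and> cis t * z \<in> E} \<le> enn2real (\<nu> (2 * (1/2) ^ j))"
    if "0 \<le> t" "t \<le> 2 * (1/2) ^ j" for t j
  proof -
    have "emeasure arc_length {z. z \<notin> E \<and> cis t * z \<in> E} \<le> \<nu> t"
      unfolding \<nu>_def l_def
      by (rule emeasure_enter_le[OF assms(1,2) \<open>E \<noteq> {}\<close> that(1)])
    also have "\<dots> \<le> \<nu> (2 * (1/2) ^ j)"
      unfolding \<nu>_def using that by (intro nn_integral_mono ennreal_leI) auto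
    finally show ?thesis
      unfolding measure_def using \<nu>_fin[of j] by (intro enn2real_mono) auto
  qed
  have bound: "(\<Sum>n\<in>F. ln (1 + real_of_int \<bar>n\<bar>) * a n) \<le> enn2real B / pi"
    if "finite F" for F :: "int set"
  proof -
    \<comment> \<open>From \<open>k < 2 ^ k\<close>, with \<open>k\<close> the sum of all
      \<open>\<bar>n\<bar>\<close> over \<open>F\<close>.\<close>
    obtain M where M: "\<bar>n\<bar> < 2 ^ M" if "n \<in> F" for n
    proof
      fix n assume "n \<in> F"
      then have "nat \<bar>n\<bar> \<le> (\<Sum>n\<in>F. nat \<bar>n\<bar>)"
        using \<open>finite F\<close> by (intro member_le_sum) auto
      then have "nat \<bar>n\<bar> < 2 ^ (\<Sum>n\<in>F. nat \<bar>n\<bar>)"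
        using less_exp le_less_trans by blast
      then have "int (nat \<bar>n\<bar>) < int (2 ^ (\<Sum>n\<in>F. nat \<bar>n\<bar>))"
        by (simp only: of_nat_less_iff)
      then show "\<bar>n\<bar> < 2 ^ (\<Sum>n\<in>F. nat \<bar>n\<bar>)" by simp
    qed
    have "(\<Sum>n\<in>F. ln (1 + real_of_int \<bar>n\<bar>) * a n)
        \<le> (\<Sum>n\<in>F. (\<Sum>j<M. if 2 ^ j \<le> \<bar>n\<bar> then 1 else 0) * a n)"
      by (intro sum_mono mult_right_mono ln_le_count_dyadic M) (auto simp: a_def)
    \<comment> \<open>Each \<open>a n\<close> is counted once for every \<open>j\<close> with
      \<open>2 ^ j \<le> \<bar>n\<bar>\<close>; exchanging the sums leaves one tail per
      scale.\<close>
    also have "\<dots> = (\<Sum>j<M. \<Sum>n\<in>F. if 2 ^ j \<le> \<bar>n\<bar> then a n else 0)"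
      unfolding sum_distrib_right by (subst sum.swap) (auto intro!: sum.cong)
    also have "\<dots> = (\<Sum>j<M. \<Sum>n\<in>{n \<in> F. 2 ^ j \<le> \<bar>n\<bar>}. a n)"
      using \<open>finite F\<close> by (simp add: sum.inter_filter)
    also have "\<dots> \<le> (\<Sum>j<M. enn2real (\<nu> (2 * (1/2) ^ j)) / pi)"
    proof (rule sum_mono)
      fix j
      show "(\<Sum>n\<in>{n \<in> F. 2 ^ j \<le> \<bar>n\<bar>}. a n) \<le> enn2real (\<nu> (2 * (1/2) ^ j)) / pi"
        unfolding a_def
      \<comment> \<open>This \<open>T\<close> is the smallest value for which
        \<open>\<bar>n\<bar> * T\<close> is at least 2 whenever \<open>\<bar>n\<bar>\<close> is at
        least \<open>2 ^ j\<close>.\<close>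
      proof (rule sum_fourier_coeff_tail_le[where T = "2 * (1/2) ^ j"])
        fix n assume "n \<in> {n \<in> F. 2 ^ j \<le> \<bar>n\<bar>}"
        then have "(2::int) ^ j \<le> \<bar>n\<bar>" by simp
        then have "real_of_int (2 ^ j) \<le> real_of_int \<bar>n\<bar>" by (simp only: of_int_le_iff)
        then show "2 \<le> real_of_int \<bar>n\<bar> * (2 * (1/2) ^ j)"
          by (simp add: power_one_over field_simps)
      qed (use \<open>finite F\<close> enter in auto)
    qed
    also have "\<dots> = enn2real (\<Sum>j<M. \<nu> (2 * (1/2) ^ j)) / pi"
      using \<nu>_fin by (simp add: sum_divide_distrib enn2real_sum)
    also have "\<dots> \<le> enn2real B / pi"
      using sum_\<nu> B by (intro divide_right_mono enn2real_mono) auto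
    finally show ?thesis .
  qed
  show ?thesis
    unfolding a_def[symmetric]
  proof (rule nonneg_bdd_above_summable_on)
    show "bdd_above (sum (\<lambda>n. ln (1 + real_of_int \<bar>n\<bar>) * a n) ` {F. F \<subseteq> UNIV \<and> finite F})"
      using bound by (intro bdd_aboveI[where M = "enn2real B / pi"]) auto
  qed (simp add: a_def)
qed

end
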